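(* Let $\mathcal{P}$ be an order-$m$, $n$-dimensional stochastic tensor, let $v$ and $x_0$ be stochastic vectors in $\mathbb{R}^n$, and let the probability $\alpha$ satisfy $\alpha<1/(m-1)$. Let $R$ be the flattening of $\mathcal{P}$ along the first index and let $\bar R=\alpha R+(1-\alpha)v\,e^T$, where $e^T$ is the all-ones row vector of length $n^{m-1}$. The inner-outer multilinear PageRank iteration $$x_{k+1}=\frac{\alpha}{m-1}\,\bar R\,(\underbrace{x_{k+1}\otimes\cdots\otimes x_{k+1}}_{m-1\text{ terms}})+\left(1-\frac{\alpha}{m-1}\right)x_k$$ converges to the unique solution $x$ of the multilinear PageRank problem $(\alpha,\mathcal{P},v)$, and also $$\|x_k-x\|_1\le\left(\frac{1-\alpha/(m-1)}{1-\alpha^2}\right)^k\|x_0-x\|_1\le 2\left(\frac{1-\alpha/(m-1)}{1-\alpha^2}\right)^k .$$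
   Context: A vector is stochastic if its entries are nonnegative and sum to $1$. An order-$m$, $n$-dimensional tensor (with $m\ge 2$) is an array with $m$ indices, each ranging over $1,\dots,n$; it is stochastic if its entries are nonnegative and, for every fixed choice of the last $m-1$ indices, the sum over the first index equals $1$. The flattening $R$ of $\mathcal{P}$ along the first index is the $n\times n^{m-1}$ matrix with $R(e_{i_m}\otimes\cdots\otimes e_{i_2})=\mathcal{P}(:,i_2,\dots,i_m)$, where $e_i$ are the standard basis vectors and $\otimes$ is the Kronecker product. In a multilinear PageRank problem $(\alpha,\mathcal{P},v)$, $\alpha$ is a probability less than $1$ and $v$ is a stochastic vector; a solution is a stochastic vector $x$ with $x=\alpha R(x\otimes\cdots\otimes x)+(1-\alpha)v$ ($m-1$ factors of $x$). For $\alpha<1/(m-1)$ the solution exists and is unique. In the iteration, $x_{k+1}$ denotes the stochastic solution of the displayed equation given $x_k$; since $\bar R$ is column stochastic and $\alpha/(m-1)<1/(m-1)$, each step is itself a multilinear PageRank problem (with $\bar R$, $\alpha/(m-1)$ and $x_k$ in place of $R$, $\alpha$ and $v$) with a unique solution.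
   Formalization: Convergence of the iteration is asserted only for α > 0; at α = 0 the iteration stays at x_0 while the solution is v, so convergence fails whenever x_0 ≠ v. Existence, uniqueness and both norm bounds are stated for all 0 ≤ α < 1/(m-1). *)

theory Defs
  imports Complex_Main "Jordan_Normal_Form.Matrix"
begin

definition stochastic_vec :: "nat \<Rightarrow> real vec \<Rightarrow> bool" where
  "stochastic_vec n x \<longleftrightarrow>
     x \<in> carrier_vec n \<and> (\<forall>i<n. 0 \<le> x $ i) \<and> (\<Sum>i<n. x $ i) = 1"

definition norm1 :: "real vec \<Rightarrow> real" where
  "norm1 x = (\<Sum>i<dim_vec x. \<bar>x $ i\<bar>)"

definition kron :: "real vec \<Rightarrow> real vec \<Rightarrow> real vec" where
  "kron u w = vec (dim_vec u * dim_vec w) (\<lambda>k. u $ (k div dim_vec w) * w $ (k mod dim_vec w))"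

text \<open>The empty Kronecker product is the vector of length one with entry one, which is
  a unit for the product.\<close>

definition kron_list :: "real vec list \<Rightarrow> real vec" where
  "kron_list vs = foldl kron (vec 1 (\<lambda>_. 1)) vs"

definition kron_power :: "nat \<Rightarrow> real vec \<Rightarrow> real vec" where
  "kron_power d x = kron_list (replicate d x)"

text \<open>A tensor of order m and dimension n is a function on index lists; indices range over
  0, ..., n - 1, and only its values on lists of length m with entries below n matter.\<close>

definition stochastic_tensor :: "nat \<Rightarrow> nat \<Rightarrow> (nat list \<Rightarrow> real) \<Rightarrow> bool" where
  "stochastic_tensor n m P \<longleftrightarrow>
     (\<forall>is. length is = m \<and> set is \<subseteq> {..<n} \<longrightarrow> 0 \<le> P is) \<and>
     (\<forall>js. length js = m - 1 \<and> set js \<subseteq> {..<n} \<longrightarrow> (\<Sum>i<n. P (i # js)) = 1)"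

text \<open>The column \<open>j\<close> of the flattening carries the multi-index \<open>i\<^sub>2, ..., i\<^sub>m\<close> formed by the
  base-n digits of \<open>j\<close>, the least significant digit being \<open>i\<^sub>2\<close>. The characterisation
  by \<open>R (e\<^bsub>i_m\<^esub> \<otimes> ... \<otimes> e\<^bsub>i_2\<^esub>) = P (:, i\<^sub>2, ..., i\<^sub>m)\<close> is lemma
  \<open>flattening_mult_kron_list\<close> below.\<close>

definition flattening :: "nat \<Rightarrow> nat \<Rightarrow> (nat list \<Rightarrow> real) \<Rightarrow> real mat" where
  "flattening n m P =
     mat n (n ^ (m - 1)) (\<lambda>(i, j). P (i # map (\<lambda>l. j div n ^ l mod n) [0..<m - 1]))"

text \<open>The matrix-level form is used both for the original problem (with the flattening of the
  tensor) and for each step of the inner-outer iteration.\<close>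

definition multilinear_pagerank_solution ::
  "nat \<Rightarrow> nat \<Rightarrow> real \<Rightarrow> real mat \<Rightarrow> real vec \<Rightarrow> real vec \<Rightarrow> bool" where
  "multilinear_pagerank_solution n m \<alpha> R v x \<longleftrightarrow>
     stochastic_vec n x \<and>
     x = \<alpha> \<cdot>\<^sub>v (R *\<^sub>v kron_power (m - 1) x) + (1 - \<alpha>) \<cdot>\<^sub>v v"

definition R_bar :: "nat \<Rightarrow> nat \<Rightarrow> real \<Rightarrow> real mat \<Rightarrow> real vec \<Rightarrow> real mat" where
  "R_bar n m \<alpha> R v =
     \<alpha> \<cdot>\<^sub>m R + (1 - \<alpha>) \<cdot>\<^sub>m (mat_of_cols n [v] * mat_of_rows (n ^ (m - 1)) [vec (n ^ (m - 1)) (\<lambda>_. 1)])"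

definition inner_outer_iteration ::
  "nat \<Rightarrow> nat \<Rightarrow> real \<Rightarrow> real mat \<Rightarrow> real vec \<Rightarrow> real vec \<Rightarrow> (nat \<Rightarrow> real vec) \<Rightarrow> bool" where
  "inner_outer_iteration n m \<alpha> R v x0 X \<longleftrightarrow>
     X 0 = x0 \<and>
     (\<forall>k. multilinear_pagerank_solution n m (\<alpha> / (real m - 1)) (R_bar n m \<alpha> R v) (X k) (X (Suc k)))"

fun column_index :: "nat \<Rightarrow> nat list \<Rightarrow> nat" where
  "column_index n [] = 0"
| "column_index n (i # is) = i + n * column_index n is"

lemma column_index_less:
  "set is \<subseteq> {..<n} \<Longrightarrow> column_index n is < n ^ length is"
proof (induction "is")
  case (Cons i "is")
  then have i: "i < n" and "column_index n is + 1 \<le> n ^ length is" by auto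
  then have "n * (column_index n is + 1) \<le> n * n ^ length is" by (intro mult_le_mono) auto
  with i show ?case by simp
qed simp

lemma digits_column_index:
  "set is \<subseteq> {..<n} \<Longrightarrow> map (\<lambda>l. column_index n is div n ^ l mod n) [0..<length is] = is"
proof (induction "is")
  case (Cons i "is")
  then have i: "i < n" by auto
  have "[0..<length (i # is)] = 0 # map Suc [0..<length is]"
    by (simp only: upt_conv_Cons map_Suc_upt length_Cons zero_less_Suc)
  moreover have "(i + n * column_index n is) div n ^ Suc l = column_index n is div n ^ l" for l
    using i by (simp add: div_mult2_eq)
  ultimately show ?case using Cons i by (simp add: o_def del: power_Suc upt_Suc)
qed simp

lemma kron_list_unit_vec:
  "set is \<subseteq> {..<n} \<Longrightarrow>
   kron_list (rev (map (unit_vec n) is)) = unit_vec (n ^ length is) (column_index n is)"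
proof (induction "is")
  case Nil
  show ?case by (auto simp: kron_list_def)
next
  case (Cons i "is")
  let ?c = "column_index n is" and ?N = "n ^ length is"
  from Cons have i: "i < n" and c: "?c < ?N" using column_index_less by auto
  have "kron_list (rev (map (unit_vec n) (i # is))) = kron (unit_vec ?N ?c) (unit_vec n i)"
    using Cons by (simp add: kron_list_def)
  also have "\<dots> = unit_vec (n ^ length (i # is)) (column_index n (i # is))"
  proof (rule eq_vecI)
    fix k assume "k < dim_vec (unit_vec (n ^ length (i # is)) (column_index n (i # is)))"
    then have k: "k < n * ?N" by simp
    then have kd: "k div n < ?N" and km: "k mod n < n"
      using i by (auto simp: less_mult_imp_div_less mult.commute)
    have "k = i + n * ?c \<longleftrightarrow> k div n = ?c \<and> k mod n = i"
      using i by (auto simp: mult.commute) (metis add.commute div_mult_mod_eq mult.commute)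
    then show "kron (unit_vec ?N ?c) (unit_vec n i) $ k =
        unit_vec (n ^ length (i # is)) (column_index n (i # is)) $ k"
      using k kd km i by (auto simp: kron_def unit_vec_def mult.commute)
  qed (simp add: kron_def mult.commute)
  finally show ?case .
qed

lemma flattening_mult_kron_list:
  assumes "length is = m - 1" and "set is \<subseteq> {..<n}"
  shows "flattening n m P *\<^sub>v kron_list (rev (map (unit_vec n) is)) = vec n (\<lambda>i. P (i # is))"
proof -
  have c: "column_index n is < n ^ (m - 1)"
    using column_index_less assms by metis
  have "flattening n m P *\<^sub>v unit_vec (n ^ (m - 1)) (column_index n is)
      = col (flattening n m P) (column_index n is)"
    using c by (intro eq_vecI) (auto simp: flattening_def)
  also have "\<dots> = vec n (\<lambda>i. P (i # is))"
    using c digits_column_index[OF assms(2)] assms(1)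
    by (intro eq_vecI) (auto simp: flattening_def)
  finally show ?thesis
    using kron_list_unit_vec[OF assms(2)] assms(1) by simp
qed

end

theory Submission
  imports Defs
begin

text \<open>
  Write \<open>f y = \<alpha> R (y \<otimes> \<dots> \<otimes> y) + (1 - \<alpha>) v\<close>, with \<open>d = m - 1\<close> factors, so that the PageRank
  vector is the fixed point of \<open>f\<close>, and put \<open>\<beta> = \<alpha> / d\<close>.

  In the one-norm the map \<open>y \<mapsto> y \<otimes> \<dots> \<otimes> y\<close> is \<open>d\<close>-Lipschitz on stochastic vectors
  (\<open>norm1_kron_power_diff_le\<close>) and a column-stochastic matrix does not increase the norm
  (\<open>norm1_stochastic_mult_le\<close>). Hence \<open>f\<close> is an \<open>\<alpha> d\<close>-contraction of the set of stochastic
  vectors, and for \<open>\<alpha> < 1 / d\<close> it has exactly one fixed point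
  (\<open>multilinear_pagerank_solution_ex1\<close>). The matrix \<open>R_bar\<close> is again column stochastic and
  \<open>\<beta> < 1 / d\<close>, so the same lemma makes every step of the iteration uniquely solvable.

  For the rate, note that \<open>R_bar\<close> applied to \<open>y \<otimes> \<dots> \<otimes> y\<close> is just \<open>f y\<close> for stochastic \<open>y\<close>,
  because the rank-one part of \<open>R_bar\<close> only sees the entry sum, which is one. The step therefore
  reads \<open>x\<^bsub>k+1\<^esub> = \<beta> f x\<^bsub>k+1\<^esub> + (1 - \<beta>) x\<^sub>k\<close>, and the solution satisfies
  \<open>x = \<beta> f x + (1 - \<beta>) x\<close>. Subtracting and using the constant \<open>\<alpha> d\<close> of \<open>f\<close> yields
  \<open>\<parallel>x\<^bsub>k+1\<^esub> - x\<parallel> \<le> \<beta> \<alpha> d \<parallel>x\<^bsub>k+1\<^esub> - x\<parallel> + (1 - \<beta>) \<parallel>x\<^sub>k - x\<parallel>\<close> with \<open>\<beta> \<alpha> d = \<alpha>\<^sup>2\<close>; solving for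
  the left-hand side gives the factor \<open>(1 - \<beta>) / (1 - \<alpha>\<^sup>2)\<close> (\<open>inner_outer_step_error\<close>). It is
  below one exactly when \<open>\<alpha>\<^sup>2 < \<alpha> / d\<close>, which is where \<open>\<alpha> > 0\<close> enters: for \<open>\<alpha> = 0\<close> the
  iteration never leaves \<open>x\<^sub>0\<close>.
\<close>

section \<open>The one-norm and stochastic vectors\<close>

lemma norm1_nonneg: "0 \<le> norm1 x"
  unfolding norm1_def by (rule sum_nonneg) simp

lemma norm1_eq_0_iff: "norm1 x = 0 \<longleftrightarrow> x = 0\<^sub>v (dim_vec x)"
  unfolding norm1_def by (subst sum_nonneg_eq_0_iff) (auto intro!: eq_vecI simp: vec_eq_iff)

lemma norm1_minus_eq_0D:
  assumes "x \<in> carrier_vec n" "y \<in> carrier_vec n" "norm1 (x - y) = 0"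
  shows "x = y"
  using assms unfolding norm1_eq_0_iff by (auto simp: vec_eq_iff)

lemma norm1_add_le:
  assumes "x \<in> carrier_vec n" "y \<in> carrier_vec n"
  shows "norm1 (x + y) \<le> norm1 x + norm1 y"
  using assms unfolding norm1_def
  by (auto simp: sum.distrib[symmetric] intro!: sum_mono)

lemma norm1_smult: "norm1 (c \<cdot>\<^sub>v x) = \<bar>c\<bar> * norm1 x"
  unfolding norm1_def by (simp add: abs_mult sum_distrib_left)

lemma abs_index_le_norm1: "i < dim_vec x \<Longrightarrow> \<bar>x $ i\<bar> \<le> norm1 x"
  unfolding norm1_def by (rule member_le_sum) auto

lemma norm1_minus_le_triangle:
  assumes "x \<in> carrier_vec n" "y \<in> carrier_vec n" "z \<in> carrier_vec n"
  shows "norm1 (x - z) \<le> norm1 (x - y) + norm1 (y - z)"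
proof -
  have "x - z = (x - y) + (y - z)" using assms by (auto simp: vec_eq_iff)
  with assms show ?thesis using norm1_add_le[of "x - y" n "y - z"] by simp
qed

lemma stochastic_vecD:
  assumes "stochastic_vec n x"
  shows stochastic_vec_carrier: "x \<in> carrier_vec n"
    and stochastic_vec_nonneg: "i < n \<Longrightarrow> 0 \<le> x $ i"
    and stochastic_vec_sum: "(\<Sum>i<n. x $ i) = 1"
    and stochastic_vec_norm1: "norm1 x = 1"
  using assms unfolding stochastic_vec_def norm1_def by auto

lemma norm1_minus_stochastic_le_2:
  assumes x: "stochastic_vec n x" and y: "stochastic_vec n y"
  shows "norm1 (x - y) \<le> 2"
proof -
  note c = x[THEN stochastic_vec_carrier] y[THEN stochastic_vec_carrier]
  have "norm1 (x - 0\<^sub>v n) \<le> 1" "norm1 (0\<^sub>v n - y) \<le> 1"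
    using c stochastic_vec_norm1[OF x] stochastic_vec_norm1[OF y] by (simp_all add: norm1_def)
  then show ?thesis using norm1_minus_le_triangle[OF c(1) zero_carrier_vec c(2)] by simp
qed

lemma stochastic_vec_convex:
  assumes "stochastic_vec n x" "stochastic_vec n y" "0 \<le> \<alpha>" "\<alpha> \<le> 1"
  shows "stochastic_vec n (\<alpha> \<cdot>\<^sub>v x + (1 - \<alpha>) \<cdot>\<^sub>v y)"
  using assms unfolding stochastic_vec_def
  by (auto simp: sum.distrib sum_distrib_left[symmetric])

section \<open>Kronecker powers\<close>

lemma kron_carrier:
  "u \<in> carrier_vec N \<Longrightarrow> w \<in> carrier_vec n \<Longrightarrow> kron u w \<in> carrier_vec (N * n)"
  by (auto simp: kron_def)

lemma kron_power_0: "kron_power 0 x = vec 1 (\<lambda>_. 1)"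
  by (simp add: kron_power_def kron_list_def)

lemma kron_power_Suc: "kron_power (Suc d) x = kron (kron_power d x) x"
  unfolding kron_power_def kron_list_def replicate_Suc replicate_append_same[symmetric]
  by simp

text \<open>Sums over the entries of a Kronecker product factor because the index \<open>k\<close> runs through all pairs
  \<open>(k div n, k mod n)\<close> exactly once.\<close>

lemma sum_div_mod:
  fixes f :: "nat \<Rightarrow> nat \<Rightarrow> real"
  shows "(\<Sum>k<N * n. f (k div n) (k mod n)) = (\<Sum>i<N. \<Sum>j<n. f i j)"
proof (cases "n = 0")
  case False
  have "i * n + j < N * n" if "i < N" "j < n" for i j
    using that mult_le_mono1[of "Suc i" N n] by simp
  then have "(\<Sum>k<N * n. f (k div n) (k mod n)) = (\<Sum>(i, j)\<in>{..<N} \<times> {..<n}. f i j)"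
    using False
    by (intro sum.reindex_bij_witness[where i = "\<lambda>(i, j). i * n + j" and j = "\<lambda>k. (k div n, k mod n)"])
      (auto simp: less_mult_imp_div_less)
  then show ?thesis by (simp add: sum.cartesian_product)
qed simp

lemma sum_kron:
  assumes "u \<in> carrier_vec N" "w \<in> carrier_vec n"
  shows "(\<Sum>k<N * n. kron u w $ k) = (\<Sum>i<N. u $ i) * (\<Sum>j<n. w $ j)"
proof -
  have "(\<Sum>k<N * n. kron u w $ k) = (\<Sum>k<N * n. u $ (k div n) * w $ (k mod n))"
    using assms by (intro sum.cong) (auto simp: kron_def)
  then show ?thesis
    by (simp add: sum_div_mod[where f = "\<lambda>i j. u $ i * w $ j"] sum_product)
qed

lemma norm1_kron: "norm1 (kron u w) = norm1 u * norm1 w"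
proof -
  have "norm1 (kron u w) = (\<Sum>k<dim_vec u * dim_vec w. 
      \<bar>u $ (k div dim_vec w)\<bar> * \<bar>w $ (k mod dim_vec w)\<bar>)"
    unfolding norm1_def by (intro sum.cong) (auto simp: kron_def abs_mult)
  then show ?thesis by (simp add: sum_div_mod[where f = "\<lambda>i j. \<bar>u $ i\<bar> * \<bar>w $ j\<bar>"]
    sum_product norm1_def)
qed

lemma stochastic_kron:
  assumes u: "stochastic_vec N u" and w: "stochastic_vec n w"
  shows "stochastic_vec (N * n) (kron u w)"
proof -
  note c = u[THEN stochastic_vec_carrier] w[THEN stochastic_vec_carrier]
  have "0 \<le> kron u w $ k" if k: "k < N * n" for k
  proof -
    from k have "0 < n" by (cases n) auto
    with k have "k div n < N" "k mod n < n" by (auto simp: less_mult_imp_div_less)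
    with k c show ?thesis
      using stochastic_vec_nonneg[OF u] stochastic_vec_nonneg[OF w] by (auto simp: kron_def)
  qed
  with c kron_carrier[OF c] sum_kron[OF c] stochastic_vec_sum[OF u] stochastic_vec_sum[OF w]
  show ?thesis unfolding stochastic_vec_def by simp
qed

lemma stochastic_kron_power:
  "stochastic_vec n x \<Longrightarrow> stochastic_vec (n ^ d) (kron_power d x)"
proof (induction d)
  case 0
  show ?case by (simp add: kron_power_0 stochastic_vec_def)
next
  case (Suc d)
  then show ?case using stochastic_kron[of "n ^ d" _ n x] by (simp add: kron_power_Suc mult.commute)
qed

text \<open>The product rule for differences. It splits a change in both factors into two changes in a single
  factor, whose norms are then multiplicative by \<open>norm1_kron\<close>.\<close>

lemma kron_minus_kron:
  assumes c: "u \<in> carrier_vec N" "u' \<in> carrier_vec N" "w \<in> carrier_vec n" "w' \<in> carrier_vec n"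
  shows "kron u w - kron u' w' = kron (u - u') w + kron u' (w - w')"
proof (rule eq_vecI)
  fix k assume "k < dim_vec (kron (u - u') w + kron u' (w - w'))"
  with c have k: "k < N * n" by (simp add: kron_def)
  then have "0 < n" by (cases n) auto
  with k have "k div n < N" "k mod n < n" by (auto simp: less_mult_imp_div_less)
  with k c show "(kron u w - kron u' w') $ k = (kron (u - u') w + kron u' (w - w')) $ k"
    by (simp add: kron_def algebra_simps)
qed (use c in \<open>simp add: kron_def\<close>)

text \<open>Replacing one factor at a time costs \<open>norm1 (x - y)\<close> per factor, since all the
  other factors are stochastic and so have norm one.\<close>

lemma norm1_kron_power_diff_le:
  assumes x: "stochastic_vec n x" and y: "stochastic_vec n y"
  shows "norm1 (kron_power d x - kron_power d y) \<le> real d * norm1 (x - y)"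
proof (induction d)
  case 0
  show ?case by (simp add: kron_power_0 norm1_def)
next
  case (Suc d)
  let ?u = "kron_power d x" and ?u' = "kron_power d y"
  note u = stochastic_kron_power[OF x, of d] and u' = stochastic_kron_power[OF y, of d]
  note c = u[THEN stochastic_vec_carrier] u'[THEN stochastic_vec_carrier]
    x[THEN stochastic_vec_carrier] y[THEN stochastic_vec_carrier]
  have "norm1 (kron ?u x - kron ?u' y) \<le> norm1 (kron (?u - ?u') x) + norm1 (kron ?u' (x - y))"
    unfolding kron_minus_kron[OF c]
    using c by (intro norm1_add_le[where n = "n ^ d * n"] kron_carrier) auto
  also have "\<dots> = norm1 (?u - ?u') + norm1 (x - y)"
    using stochastic_vec_norm1[OF x] stochastic_vec_norm1[OF u'] by (simp add: norm1_kron)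
  also have "\<dots> \<le> real (Suc d) * norm1 (x - y)" using Suc by (simp add: algebra_simps)
  finally show ?case by (simp add: kron_power_Suc)
qed

section \<open>Column-stochastic matrices\<close>

definition stochastic_mat :: "nat \<Rightarrow> nat \<Rightarrow> real mat \<Rightarrow> bool" where
  "stochastic_mat n N R \<longleftrightarrow> R \<in> carrier_mat n N \<and>
     (\<forall>i<n. \<forall>j<N. 0 \<le> R $$ (i, j)) \<and> (\<forall>j<N. (\<Sum>i<n. R $$ (i, j)) = 1)"

lemma index_mult_mat_vec_sum:
  assumes "R \<in> carrier_mat n N" "w \<in> carrier_vec N" "i < n"
  shows "(R *\<^sub>v w) $ i = (\<Sum>j<N. R $$ (i, j) * w $ j)"
  using assms by (auto simp: scalar_prod_def atLeast0LessThan intro!: sum.cong)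

lemma stochastic_mult_mat_vec:
  assumes R: "stochastic_mat n N R" and w: "stochastic_vec N w"
  shows "stochastic_vec n (R *\<^sub>v w)"
proof -
  have c: "R \<in> carrier_mat n N" using R by (simp add: stochastic_mat_def)
  note idx = index_mult_mat_vec_sum[OF c stochastic_vec_carrier[OF w]]
  have "(\<Sum>i<n. (R *\<^sub>v w) $ i) = (\<Sum>i<n. \<Sum>j<N. R $$ (i, j) * w $ j)"
    by (simp add: idx del: index_mult_mat_vec)
  also have "\<dots> = (\<Sum>j<N. (\<Sum>i<n. R $$ (i, j)) * w $ j)"
    by (subst sum.swap) (simp add: sum_distrib_right)
  also have "\<dots> = 1" using R stochastic_vec_sum[OF w] by (simp add: stochastic_mat_def)
  finally have "(\<Sum>i<n. (R *\<^sub>v w) $ i) = 1" .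
  moreover have "0 \<le> (R *\<^sub>v w) $ i" if "i < n" for i
    using R stochastic_vec_nonneg[OF w] that
    by (auto simp: stochastic_mat_def idx simp del: index_mult_mat_vec intro!: sum_nonneg)
  moreover have "R *\<^sub>v w \<in> carrier_vec n" 
    by (intro mult_mat_vec_carrier[OF c] stochastic_vec_carrier[OF w])
  ultimately show ?thesis unfolding stochastic_vec_def by blast
qed

lemma norm1_stochastic_mult_le:
  assumes R: "stochastic_mat n N R" and w: "w \<in> carrier_vec N"
  shows "norm1 (R *\<^sub>v w) \<le> norm1 w"
proof -
  have c: "R \<in> carrier_mat n N" using R by (simp add: stochastic_mat_def)
  have "norm1 (R *\<^sub>v w) = (\<Sum>i<n. \<bar>\<Sum>j<N. R $$ (i, j) * w $ j\<bar>)"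
    using c by (auto simp: norm1_def index_mult_mat_vec_sum[OF c w] simp del: index_mult_mat_vec)
  also have "\<dots> \<le> (\<Sum>i<n. \<Sum>j<N. R $$ (i, j) * \<bar>w $ j\<bar>)"
    using R by (intro sum_mono order.trans[OF sum_abs]) (auto simp: abs_mult stochastic_mat_def)
  also have "\<dots> = (\<Sum>j<N. (\<Sum>i<n. R $$ (i, j)) * \<bar>w $ j\<bar>)"
    by (subst sum.swap) (simp add: sum_distrib_right)
  also have "\<dots> = norm1 w" using R w by (simp add: stochastic_mat_def norm1_def)
  finally show ?thesis .
qed

lemma norm1_stochastic_mult_diff_le:
  assumes R: "stochastic_mat n N R" and w: "w \<in> carrier_vec N" "w' \<in> carrier_vec N"
  shows "norm1 (R *\<^sub>v w - R *\<^sub>v w') \<le> norm1 (w - w')"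
proof -
  have "R \<in> carrier_mat n N" using R by (simp add: stochastic_mat_def)
  then have "R *\<^sub>v w - R *\<^sub>v w' = R *\<^sub>v (w - w')" using mult_minus_distrib_mat_vec w by metis
  then show ?thesis using norm1_stochastic_mult_le[OF R, of "w - w'"] w by simp
qed

text \<open>Every column index below \<open>n ^ (m - 1)\<close> encodes a legal tuple of \<open>m - 1\<close> indices, so the columns
  of the flattening are fibres of the tensor along its first index.\<close>

lemma stochastic_flattening:
  assumes P: "stochastic_tensor n m P" and m: "2 \<le> m"
  shows "stochastic_mat n (n ^ (m - 1)) (flattening n m P)"
proof -
  let ?js = "\<lambda>j. map (\<lambda>l. j div n ^ l mod n) [0..<m - 1]"
  have len: "length (?js j) = m - 1" for j by simp
  have digits: "set (?js j) \<subseteq> {..<n}" if "j < n ^ (m - 1)" for j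
  proof -
    have "n \<noteq> 0" using that m by (cases "n = 0") (simp_all add: power_0_left)
    then show ?thesis by auto
  qed
  have "0 \<le> P (i # ?js j)" if "i < n" "j < n ^ (m - 1)" for i j
  proof -
    have "length (i # ?js j) = m" "set (i # ?js j) \<subseteq> {..<n}" using that digits m by auto
    then show ?thesis using P unfolding stochastic_tensor_def by blast
  qed
  moreover have "(\<Sum>i<n. P (i # ?js j)) = 1" if "j < n ^ (m - 1)" for j
    using P len digits[OF that] unfolding stochastic_tensor_def by blast
  ultimately show ?thesis
    by (auto simp: stochastic_mat_def flattening_def)
qed

lemma index_R_bar:
  assumes "R \<in> carrier_mat n (n ^ (m - 1))" "v \<in> carrier_vec n" "i < n" "j < n ^ (m - 1)"
  shows "R_bar n m \<alpha> R v $$ (i, j) = \<alpha> * R $$ (i, j) + (1 - \<alpha>) * v $ i"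
  using assms by (auto simp: R_bar_def mat_of_cols_def mat_of_rows_def scalar_prod_def)

lemma R_bar_carrier:
  "R \<in> carrier_mat n (n ^ (m - 1)) \<Longrightarrow> R_bar n m \<alpha> R v \<in> carrier_mat n (n ^ (m - 1))"
  by (auto simp: R_bar_def)

lemma stochastic_R_bar:
  assumes R: "stochastic_mat n (n ^ (m - 1)) R" and v: "stochastic_vec n v"
    and \<alpha>: "0 \<le> \<alpha>" "\<alpha> \<le> 1"
  shows "stochastic_mat n (n ^ (m - 1)) (R_bar n m \<alpha> R v)"
proof -
  have c: "R \<in> carrier_mat n (n ^ (m - 1))" using R by (simp add: stochastic_mat_def)
  note idx = index_R_bar[OF c stochastic_vec_carrier[OF v]]
  have "(\<Sum>i<n. R_bar n m \<alpha> R v $$ (i, j)) = 1" if "j < n ^ (m - 1)" for j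
    using that R stochastic_vec_sum[OF v]
    by (simp add: idx sum.distrib sum_distrib_left[symmetric] stochastic_mat_def)
  then show ?thesis using R \<alpha> R_bar_carrier[OF c] stochastic_vec_nonneg[OF v]
    by (auto simp: stochastic_mat_def idx)
qed

text \<open>The rank-one term of \<open>R_bar\<close> multiplies \<open>v\<close> by the entry sum of \<open>w\<close>, which is one. Thus on
  stochastic vectors the linear map \<open>R_bar\<close> agrees with the affine map of the PageRank equation.\<close>

lemma R_bar_mult_stochastic:
  assumes R: "R \<in> carrier_mat n (n ^ (m - 1))" and v: "v \<in> carrier_vec n"
    and w: "stochastic_vec (n ^ (m - 1)) w"
  shows "R_bar n m \<alpha> R v *\<^sub>v w = \<alpha> \<cdot>\<^sub>v (R *\<^sub>v w) + (1 - \<alpha>) \<cdot>\<^sub>v v"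
proof (rule eq_vecI)
  let ?N = "n ^ (m - 1)"
  fix i assume "i < dim_vec (\<alpha> \<cdot>\<^sub>v (R *\<^sub>v w) + (1 - \<alpha>) \<cdot>\<^sub>v v)"
  with v have i: "i < n" by simp
  note wc = stochastic_vec_carrier[OF w]
  have "(R_bar n m \<alpha> R v *\<^sub>v w) $ i = (\<Sum>j<?N. (\<alpha> * R $$ (i, j) + (1 - \<alpha>) * v $ i) * w $ j)"
    using i by (simp add: index_mult_mat_vec_sum[OF R_bar_carrier[OF R] wc] index_R_bar[OF R v])
  also have "\<dots> = \<alpha> * (\<Sum>j<?N. R $$ (i, j) * w $ j) + (1 - \<alpha>) * v $ i * (\<Sum>j<?N. w $ j)"
    by (simp add: distrib_right sum.distrib sum_distrib_left mult.assoc)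
  also have "\<dots> = (\<alpha> \<cdot>\<^sub>v (R *\<^sub>v w) + (1 - \<alpha>) \<cdot>\<^sub>v v) $ i"
    using i v R stochastic_vec_sum[OF w]
    by (simp add: index_mult_mat_vec_sum[OF R wc] del: index_mult_mat_vec)
  finally show "(R_bar n m \<alpha> R v *\<^sub>v w) $ i = (\<alpha> \<cdot>\<^sub>v (R *\<^sub>v w) + (1 - \<alpha>) \<cdot>\<^sub>v v) $ i" .
qed (use R v R_bar_carrier[OF R] in auto)

text \<open>For \<open>\<alpha> \<le> 1\<close> the matrix \<open>R_bar\<close> is column stochastic, so it has Lipschitz constant
  one. Between vectors of equal entry sum the rank-one term cancels, which improves the constant
  to \<open>\<alpha>\<close>; this gain is what makes the iteration converge at the claimed rate.\<close>

lemma norm1_R_bar_mult_diff_le: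
  assumes R: "stochastic_mat n (n ^ (m - 1)) R" and v: "v \<in> carrier_vec n" and \<alpha>: "0 \<le> \<alpha>"
    and w: "stochastic_vec (n ^ (m - 1)) w" and w': "stochastic_vec (n ^ (m - 1)) w'"
  shows "norm1 (R_bar n m \<alpha> R v *\<^sub>v w - R_bar n m \<alpha> R v *\<^sub>v w') \<le> \<alpha> * norm1 (w - w')"
proof -
  have c: "R \<in> carrier_mat n (n ^ (m - 1))" using R by (simp add: stochastic_mat_def)
  have "R_bar n m \<alpha> R v *\<^sub>v w - R_bar n m \<alpha> R v *\<^sub>v w' = \<alpha> \<cdot>\<^sub>v (R *\<^sub>v w - R *\<^sub>v w')"
    using c v unfolding R_bar_mult_stochastic[OF c v w] R_bar_mult_stochastic[OF c v w']
    by (auto simp: vec_eq_iff algebra_simps simp del: index_mult_mat_vec)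
  then show ?thesis
    using norm1_stochastic_mult_diff_le[OF R, of w w'] \<alpha>
      w[THEN stochastic_vec_carrier] w'[THEN stochastic_vec_carrier]
    by (simp add: norm1_smult mult_left_mono)
qed

section \<open>Existence and uniqueness of multilinear PageRank vectors\<close>

text \<open>The Lipschitz constant \<open>L\<close> of the matrix on stochastic vectors is kept as a parameter, because
  the estimate serves two purposes: with \<open>L = 1\<close> it gives unique solvability, and with \<open>R_bar\<close> and
  \<open>L = \<alpha>\<close> it compares an iterate with the solution.\<close>

lemma norm1_pagerank_map_diff_le:
  assumes R: "R \<in> carrier_mat n (n ^ d)" and \<beta>: "0 \<le> \<beta>" "\<beta> \<le> 1" and L: "0 \<le> L"
    and lipschitz: "\<And>w w'. stochastic_vec (n ^ d) w \<Longrightarrow> stochastic_vec (n ^ d) w' \<Longrightarrow>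
      norm1 (R *\<^sub>v w - R *\<^sub>v w') \<le> L * norm1 (w - w')"
    and v: "v \<in> carrier_vec n" "v' \<in> carrier_vec n"
    and y: "stochastic_vec n y" and y': "stochastic_vec n y'"
  shows "norm1 ((\<beta> \<cdot>\<^sub>v (R *\<^sub>v kron_power d y) + (1 - \<beta>) \<cdot>\<^sub>v v)
      - (\<beta> \<cdot>\<^sub>v (R *\<^sub>v kron_power d y') + (1 - \<beta>) \<cdot>\<^sub>v v'))
    \<le> \<beta> * L * real d * norm1 (y - y') + (1 - \<beta>) * norm1 (v - v')"
    (is "norm1 (?lhs) \<le> _")
proof -
  let ?w = "kron_power d y" and ?w' = "kron_power d y'"
  have Rw: "R *\<^sub>v ?w \<in> carrier_vec n" "R *\<^sub>v ?w' \<in> carrier_vec n"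
    using stochastic_vec_carrier[OF stochastic_kron_power[OF y]]
      stochastic_vec_carrier[OF stochastic_kron_power[OF y']]
    by (auto intro: mult_mat_vec_carrier[OF R])
  have "?lhs = \<beta> \<cdot>\<^sub>v (R *\<^sub>v ?w - R *\<^sub>v ?w') + (1 - \<beta>) \<cdot>\<^sub>v (v - v')"
    using R v by (auto simp: vec_eq_iff algebra_simps simp del: index_mult_mat_vec)
  then have "norm1 ?lhs \<le> \<beta> * norm1 (R *\<^sub>v ?w - R *\<^sub>v ?w') + (1 - \<beta>) * norm1 (v - v')"
    using norm1_add_le[of "\<beta> \<cdot>\<^sub>v (R *\<^sub>v ?w - R *\<^sub>v ?w')" n "(1 - \<beta>) \<cdot>\<^sub>v (v - v')"] Rw v \<beta>
    by (simp add: norm1_smult)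
  also have "\<beta> * norm1 (R *\<^sub>v ?w - R *\<^sub>v ?w') \<le> \<beta> * (L * (real d * norm1 (y - y')))"
  proof (rule mult_left_mono[OF _ \<beta>(1)])
    have "norm1 (R *\<^sub>v ?w - R *\<^sub>v ?w') \<le> L * norm1 (?w - ?w')"
      using lipschitz stochastic_kron_power y y' by blast
    also have "\<dots> \<le> L * (real d * norm1 (y - y'))"
      by (rule mult_left_mono[OF norm1_kron_power_diff_le[OF y y'] L])
    finally show "norm1 (R *\<^sub>v ?w - R *\<^sub>v ?w') \<le> L * (real d * norm1 (y - y'))" .
  qed
  finally show ?thesis by (simp add: mult.assoc)
qed

text \<open>Banach's fixed point theorem on the simplex. The type of vectors mixes all dimensions and
  carries no metric, so completeness is used entrywise: the Picard iterates have geometrically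
  decaying increments, hence converge in each entry, and the simplex is closed.\<close>

lemma stochastic_contraction_fixpoint:
  fixes F :: "real vec \<Rightarrow> real vec"
  assumes closed: "\<And>y. stochastic_vec n y \<Longrightarrow> stochastic_vec n (F y)"
    and contraction: "\<And>y z. stochastic_vec n y \<Longrightarrow> stochastic_vec n z \<Longrightarrow>
      norm1 (F y - F z) \<le> c * norm1 (y - z)"
    and c: "0 \<le> c" "c < 1" and y0: "stochastic_vec n y0"
  shows "\<exists>x. stochastic_vec n x \<and> F x = x"
proof -
  define Y where "Y k = (F ^^ k) y0" for k
  have Y_Suc: "Y (Suc k) = F (Y k)" for k by (simp add: Y_def)
  have Y: "stochastic_vec n (Y k)" for k by (induction k) (simp_all add: Y_def y0 closed)
  note Yc = Y[THEN stochastic_vec_carrier]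
  have step: "norm1 (Y (Suc k) - Y k) \<le> c ^ k * norm1 (Y 1 - Y 0)" for k
  proof (induction k)
    case (Suc k)
    have "norm1 (Y (Suc (Suc k)) - Y (Suc k)) \<le> c * norm1 (Y (Suc k) - Y k)"
      using contraction[OF Y Y, of "Suc k" k] by (simp add: Y_Suc)
    also have "\<dots> \<le> c * (c ^ k * norm1 (Y 1 - Y 0))" by (rule mult_left_mono[OF Suc c(1)])
    finally show ?case by simp
  qed simp
  have conv: "convergent (\<lambda>k. Y k $ i)" if i: "i < n" for i
  proof -
    have "summable (\<lambda>k. Y (Suc k) $ i - Y k $ i)"
    proof (rule summable_comparison_test')
      show "summable (\<lambda>k. c ^ k * norm1 (Y 1 - Y 0))"
        using c by (intro summable_mult2 summable_geometric) simp
      fix k :: nat assume "0 \<le> k"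
      show "norm (Y (Suc k) $ i - Y k $ i) \<le> c ^ k * norm1 (Y 1 - Y 0)"
        using abs_index_le_norm1[of i "Y (Suc k) - Y k"] step[of k] Yc[of k] i by simp
    qed
    then show ?thesis
      unfolding summable_iff_convergent sum_lessThan_telescope[where f = "\<lambda>k. Y k $ i"]
      by (simp add: convergent_diff_const_right_iff)
  qed
  define x where "x = vec n (\<lambda>i. lim (\<lambda>k. Y k $ i))"
  have xc: "x \<in> carrier_vec n" by (simp add: x_def)
  have lim: "(\<lambda>k. Y k $ i) \<longlonglongrightarrow> x $ i" if "i < n" for i
    using conv[OF that] that by (simp add: x_def convergent_LIMSEQ_iff)
  have "stochastic_vec n x"
    unfolding stochastic_vec_def
  proof (intro conjI allI impI)
    fix i assume i: "i < n"
    show "0 \<le> x $ i"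
      by (rule LIMSEQ_le_const[OF lim[OF i]]) (use stochastic_vec_nonneg[OF Y i] in blast)
  next
    have "(\<lambda>k. \<Sum>i<n. Y k $ i) \<longlonglongrightarrow> (\<Sum>i<n. x $ i)" by (intro tendsto_sum lim) simp
    then show "(\<Sum>i<n. x $ i) = 1"
      using LIMSEQ_unique[OF _ tendsto_const[of 1]] by (simp add: stochastic_vec_sum[OF Y])
  qed (rule xc)
  moreover have "F x = x"
  proof -
    have "(\<lambda>k. \<Sum>i<n. \<bar>Y k $ i - x $ i\<bar>) \<longlonglongrightarrow> (\<Sum>i<n. \<bar>x $ i - x $ i\<bar>)"
      by (intro tendsto_intros lim) auto
    then have null: "(\<lambda>k. norm1 (Y k - x)) \<longlonglongrightarrow> 0"
      using xc by (simp add: norm1_def)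
    have Fx: "stochastic_vec n (F x)" using closed calculation .
    note Fxc = stochastic_vec_carrier[OF Fx]
    \<comment> \<open>The contraction property doubles as continuity of \<open>F\<close>, so \<open>Y (Suc k)\<close> tends to \<open>F x\<close> too.\<close>
    have "norm1 (F x - x) \<le> c * norm1 (Y k - x) + norm1 (Y (Suc k) - x)" for k
    proof -
      have "norm1 (F x - Y (Suc k)) \<le> c * norm1 (x - Y k)"
        unfolding Y_Suc by (rule contraction[OF \<open>stochastic_vec n x\<close> Y])
      moreover have "norm1 (x - Y k) = norm1 (Y k - x)"
        using xc Yc[of k] by (simp add: norm1_def abs_minus_commute)
      ultimately show ?thesis
        using norm1_minus_le_triangle[OF Fxc Yc[of "Suc k"] xc] by simp
    qed
    moreover have "(\<lambda>k. c * norm1 (Y k - x) + norm1 (Y (Suc k) - x)) \<longlonglongrightarrow> c * 0 + 0"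
      by (intro tendsto_intros null LIMSEQ_Suc)
    ultimately have "norm1 (F x - x) \<le> 0"
      by (metis (no_types, lifting) LIMSEQ_le_const add.right_neutral mult_zero_right)
    then show ?thesis using norm1_minus_eq_0D[OF Fxc xc] norm1_nonneg[of "F x - x"] by linarith
  qed
  ultimately show ?thesis by blast
qed

lemma multilinear_pagerank_solution_ex1:
  assumes R: "stochastic_mat n (n ^ (m - 1)) R" and v: "stochastic_vec n v"
    and \<beta>: "0 \<le> \<beta>" "\<beta> < 1 / (real m - 1)" and m: "2 \<le> m"
  shows "\<exists>!x. multilinear_pagerank_solution n m \<beta> R v x"
proof -
  define F where "F y = \<beta> \<cdot>\<^sub>v (R *\<^sub>v kron_power (m - 1) y) + (1 - \<beta>) \<cdot>\<^sub>v v" for y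
  have sol: "multilinear_pagerank_solution n m \<beta> R v x \<longleftrightarrow> stochastic_vec n x \<and> F x = x" for x
    by (auto simp: multilinear_pagerank_solution_def F_def)
  have c: "R \<in> carrier_mat n (n ^ (m - 1))" using R by (simp add: stochastic_mat_def)
  note vc = stochastic_vec_carrier[OF v]
  have q: "\<beta> * real (m - 1) < 1" using \<beta> m by (simp add: field_simps of_nat_diff)
  have "\<beta> * 1 \<le> \<beta> * real (m - 1)" using \<beta> m by (intro mult_left_mono) auto
  then have \<beta>1: "\<beta> \<le> 1" using q by simp
  have contraction: "norm1 (F y - F z) \<le> \<beta> * real (m - 1) * norm1 (y - z)"
    if "stochastic_vec n y" "stochastic_vec n z" for y z
  proof -
    have "norm1 (v - v) = 0" by (simp add: norm1_def)
    then show ?thesis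
      using norm1_pagerank_map_diff_le[OF c \<beta>(1) \<beta>1, of 1 v v y z]
        norm1_stochastic_mult_diff_le[OF R] stochastic_vec_carrier vc that
      by (simp add: F_def)
  qed
  have closed: "stochastic_vec n (F y)" if "stochastic_vec n y" for y
    unfolding F_def using that \<beta> \<beta>1
    by (intro stochastic_vec_convex stochastic_mult_mat_vec[OF R] stochastic_kron_power v)
  have "\<exists>x. stochastic_vec n x \<and> F x = x"
    using stochastic_contraction_fixpoint[OF closed contraction _ q v] \<beta> by simp
  moreover have "x = y" if x: "stochastic_vec n x \<and> F x = x" and y: "stochastic_vec n y \<and> F y = y" for x y
  proof -
    have "norm1 (x - y) \<le> \<beta> * real (m - 1) * norm1 (x - y)" using contraction[of x y] x y by simp
    then have "(1 - \<beta> * real (m - 1)) * norm1 (x - y) \<le> 0" by (simp add: algebra_simps)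
    then have "norm1 (x - y) = 0"
      using q norm1_nonneg[of "x - y"] by (simp add: mult_le_0_iff)
    then show ?thesis using norm1_minus_eq_0D stochastic_vec_carrier x y by blast
  qed
  ultimately show ?thesis unfolding sol by blast
qed

section \<open>The inner-outer iteration\<close>

text \<open>Each step determines the next iterate, so the sequence is obtained by recursion through definite
  description; the invariant is that all iterates stay stochastic.\<close>

lemma inner_outer_iteration_ex1:
  assumes step: "\<And>x. stochastic_vec n x \<Longrightarrow>
      \<exists>!y. multilinear_pagerank_solution n m (\<alpha> / (real m - 1)) (R_bar n m \<alpha> R v) x y"
    and x0: "stochastic_vec n x0"
  shows "\<exists>!X. inner_outer_iteration n m \<alpha> R v x0 X"
proof -
  let ?S = "multilinear_pagerank_solution n m (\<alpha> / (real m - 1)) (R_bar n m \<alpha> R v)"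
  have S_stoch: "?S x y \<Longrightarrow> stochastic_vec n y" for x y
    by (simp add: multilinear_pagerank_solution_def)
  define X where "X = rec_nat x0 (\<lambda>_ x. THE y. ?S x y)"
  have X0: "X 0 = x0" and XS: "X (Suc k) = (THE y. ?S (X k) y)" for k by (simp_all add: X_def)
  have stoch: "stochastic_vec n (X k)" for k
    by (induction k) (use x0 S_stoch theI'[OF step] in \<open>auto simp: X0 XS\<close>)
  have iter: "inner_outer_iteration n m \<alpha> R v x0 X"
    unfolding inner_outer_iteration_def XS using theI'[OF step[OF stoch]] X0 by blast
  moreover have "Z = X" if "inner_outer_iteration n m \<alpha> R v x0 Z" for Z
  proof
    fix k show "Z k = X k"
    proof (induction k)
      case (Suc k)
      then have "?S (X k) (Z (Suc k))" "?S (X k) (X (Suc k))"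
        using that iter unfolding inner_outer_iteration_def by metis+
      then show ?case using step[OF stoch] by blast
    qed (use that X0 in \<open>simp add: inner_outer_iteration_def\<close>)
  qed
  ultimately show ?thesis by blast
qed

text \<open>By \<open>R_bar_mult_stochastic\<close>, \<open>R_bar\<close> maps the Kronecker power of a solution \<open>x\<close> to \<open>x\<close> itself,
  so \<open>x\<close> solves every convex combination of this equation with \<open>x = x\<close>.\<close>

lemma solution_is_inner_step_fixpoint:
  assumes R: "R \<in> carrier_mat n (n ^ (m - 1))" and v: "v \<in> carrier_vec n"
    and x: "multilinear_pagerank_solution n m \<alpha> R v x"
  shows "multilinear_pagerank_solution n m \<beta> (R_bar n m \<alpha> R v) x x"
proof -
  have sx: "stochastic_vec n x" using x by (simp add: multilinear_pagerank_solution_def)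
  have "R_bar n m \<alpha> R v *\<^sub>v kron_power (m - 1) x = x"
    using x R_bar_mult_stochastic[OF R v stochastic_kron_power[OF sx], of \<alpha>]
    by (simp add: multilinear_pagerank_solution_def)
  then show ?thesis using sx
    by (auto simp: multilinear_pagerank_solution_def add_smult_distrib_vec[symmetric])
qed

text \<open>The step is implicit: its error appears on both sides of the estimate, with factor
  \<open>\<alpha> / (m - 1) \<cdot> \<alpha> (m - 1) = \<alpha>\<^sup>2 < 1\<close> on the right. Absorbing that term produces the
  denominator \<open>1 - \<alpha>\<^sup>2\<close>.\<close>

lemma inner_outer_step_error:
  assumes R: "stochastic_mat n (n ^ (m - 1)) R" and v: "stochastic_vec n v" and m: "2 \<le> m"
    and \<alpha>: "0 \<le> \<alpha>" "\<alpha> < 1"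
    and x: "multilinear_pagerank_solution n m \<alpha> R v x"
    and y: "stochastic_vec n y"
    and z: "multilinear_pagerank_solution n m (\<alpha> / (real m - 1)) (R_bar n m \<alpha> R v) y z"
  shows "norm1 (z - x) \<le> (1 - \<alpha> / (real m - 1)) / (1 - \<alpha>\<^sup>2) * norm1 (y - x)"
proof -
  let ?\<beta> = "\<alpha> / (real m - 1)" and ?B = "R_bar n m \<alpha> R v"
  have c: "R \<in> carrier_mat n (n ^ (m - 1))" using R by (simp add: stochastic_mat_def)
  note vc = stochastic_vec_carrier[OF v]
  have sx: "stochastic_vec n x" and sz: "stochastic_vec n z"
    using x z by (simp_all add: multilinear_pagerank_solution_def)
  have \<beta>: "0 \<le> ?\<beta>" "?\<beta> \<le> 1" using \<alpha> m by (auto simp: field_simps)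
  have "x = ?\<beta> \<cdot>\<^sub>v (?B *\<^sub>v kron_power (m - 1) x) + (1 - ?\<beta>) \<cdot>\<^sub>v x"
    using solution_is_inner_step_fixpoint[OF c vc x] by (simp add: multilinear_pagerank_solution_def)
  moreover have "z = ?\<beta> \<cdot>\<^sub>v (?B *\<^sub>v kron_power (m - 1) z) + (1 - ?\<beta>) \<cdot>\<^sub>v y"
    using z by (simp add: multilinear_pagerank_solution_def)
  ultimately have "norm1 (z - x)
      \<le> ?\<beta> * \<alpha> * real (m - 1) * norm1 (z - x) + (1 - ?\<beta>) * norm1 (y - x)"
    using norm1_pagerank_map_diff_le[OF R_bar_carrier[OF c] \<beta> \<alpha>(1)
        norm1_R_bar_mult_diff_le[OF R vc \<alpha>(1)]
        stochastic_vec_carrier[OF y] stochastic_vec_carrier[OF sx] sz sx]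
    by simp
  also have "?\<beta> * \<alpha> * real (m - 1) = \<alpha>\<^sup>2"
    using m by (simp add: of_nat_diff power2_eq_square)
  finally have "(1 - \<alpha>\<^sup>2) * norm1 (z - x) \<le> (1 - ?\<beta>) * norm1 (y - x)" by (simp add: algebra_simps)
  moreover have "\<alpha>\<^sup>2 < 1" using \<alpha> by (simp add: power_less_one_iff)
  ultimately show ?thesis by (simp add: field_simps)
qed

theorem theorem5p4:
  fixes n m :: nat and P :: "nat list \<Rightarrow> real" and v x\<^sub>0 :: "real vec" and \<alpha> :: real
  assumes "2 \<le> m"
    and "stochastic_tensor n m P"
    and "stochastic_vec n v"
    and "stochastic_vec n x\<^sub>0"
    and "0 \<le> \<alpha>"
    and "\<alpha> < 1 / (real m - 1)"
  shows "(\<exists>!x. multilinear_pagerank_solution n m \<alpha> (flattening n m P) v x) \<and>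
    (\<exists>!X. inner_outer_iteration n m \<alpha> (flattening n m P) v x\<^sub>0 X) \<and>
    (\<forall>x X. multilinear_pagerank_solution n m \<alpha> (flattening n m P) v x \<longrightarrow>
       inner_outer_iteration n m \<alpha> (flattening n m P) v x\<^sub>0 X \<longrightarrow>
       (0 < \<alpha> \<longrightarrow> (\<forall>i<n. (\<lambda>k. X k $ i) \<longlonglongrightarrow> x $ i)) \<and>
       (\<forall>k. norm1 (X k - x) \<le> ((1 - \<alpha> / (real m - 1)) / (1 - \<alpha>\<^sup>2)) ^ k * norm1 (x\<^sub>0 - x) \<and>
            ((1 - \<alpha> / (real m - 1)) / (1 - \<alpha>\<^sup>2)) ^ k * norm1 (x\<^sub>0 - x)
              \<le> 2 * ((1 - \<alpha> / (real m - 1)) / (1 - \<alpha>\<^sup>2)) ^ k))"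
proof -
  let ?R = "flattening n m P"
  let ?\<beta> = "\<alpha> / (real m - 1)"
  let ?q = "(1 - ?\<beta>) / (1 - \<alpha>\<^sup>2)"
  note m = assms(1) and v = assms(3) and x0 = assms(4) and \<alpha>0 = assms(5) and \<alpha> = assms(6)
  have R: "stochastic_mat n (n ^ (m - 1)) ?R" by (rule stochastic_flattening[OF assms(2) m])
  have "1 / (real m - 1) \<le> 1" using m by simp
  then have \<alpha>1: "\<alpha> < 1" using \<alpha> by linarith
  have \<beta>: "0 \<le> ?\<beta>" "?\<beta> < 1 / (real m - 1)"
    using \<alpha>0 \<alpha>1 m by (auto intro: divide_strict_right_mono)
  then have \<beta>1: "?\<beta> < 1" using \<open>1 / (real m - 1) \<le> 1\<close> by linarith
  have sq: "\<alpha>\<^sup>2 < 1" using \<alpha>0 \<alpha>1 by (simp add: power_less_one_iff)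
  have B: "stochastic_mat n (n ^ (m - 1)) (R_bar n m \<alpha> ?R v)"
    using stochastic_R_bar[OF R v \<alpha>0] \<alpha>1 by simp
  have "\<exists>!x. multilinear_pagerank_solution n m \<alpha> ?R v x"
    by (rule multilinear_pagerank_solution_ex1[OF R v \<alpha>0 \<alpha> m])
  moreover have "\<exists>!X. inner_outer_iteration n m \<alpha> ?R v x\<^sub>0 X"
    by (rule inner_outer_iteration_ex1[OF multilinear_pagerank_solution_ex1[OF B _ \<beta>(1,2) m] x0])
  moreover have "(0 < \<alpha> \<longrightarrow> (\<forall>i<n. (\<lambda>k. X k $ i) \<longlonglongrightarrow> x $ i)) \<and>
      (\<forall>k. norm1 (X k - x) \<le> ?q ^ k * norm1 (x\<^sub>0 - x) \<and>
        ?q ^ k * norm1 (x\<^sub>0 - x) \<le> 2 * ?q ^ k)"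
    if x: "multilinear_pagerank_solution n m \<alpha> ?R v x"
      and X: "inner_outer_iteration n m \<alpha> ?R v x\<^sub>0 X" for x X
  proof -
    have X0: "X 0 = x\<^sub>0"
      and XS: "multilinear_pagerank_solution n m ?\<beta> (R_bar n m \<alpha> ?R v) (X k) (X (Suc k))" for k
      using X by (simp_all add: inner_outer_iteration_def)
    have sx: "stochastic_vec n x" using x by (simp add: multilinear_pagerank_solution_def)
    have sX: "stochastic_vec n (X k)" for k
      using X0 x0 XS by (cases k) (auto simp: multilinear_pagerank_solution_def)
    have q0: "0 \<le> ?q" using \<beta>1 sq by simp
    have bound: "norm1 (X k - x) \<le> ?q ^ k * norm1 (x\<^sub>0 - x)" for k
    proof (induction k)
      case (Suc k)
      have "norm1 (X (Suc k) - x) \<le> ?q * norm1 (X k - x)"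
        by (rule inner_outer_step_error[OF R v m \<alpha>0 \<alpha>1 x sX XS])
      also have "\<dots> \<le> ?q * (?q ^ k * norm1 (x\<^sub>0 - x))" by (rule mult_left_mono[OF Suc q0])
      finally show ?case by simp
    qed (simp add: X0)
    have "?q ^ k * norm1 (x\<^sub>0 - x) \<le> 2 * ?q ^ k" for k
      using mult_left_mono[OF norm1_minus_stochastic_le_2[OF x0 sx] zero_le_power[OF q0, of k]]
      by (simp add: mult.commute)
    moreover have "(\<lambda>k. X k $ i) \<longlonglongrightarrow> x $ i" if pos: "0 < \<alpha>" and i: "i < n" for i
    proof -
      \<comment> \<open>The bound on \<open>\<alpha>\<close>, multiplied by \<open>\<alpha> > 0\<close>, says that \<open>?q < 1\<close>.\<close>
      have "\<alpha> * \<alpha> < \<alpha> * (1 / (real m - 1))" by (rule mult_strict_left_mono[OF \<alpha> pos])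
      then have "\<alpha>\<^sup>2 < ?\<beta>" by (simp add: power2_eq_square)
      then have "?q < 1" using sq by simp
      then have "(\<lambda>k. ?q ^ k) \<longlonglongrightarrow> 0" using q0 by (intro LIMSEQ_realpow_zero)
      then have null: "(\<lambda>k. ?q ^ k * norm1 (x\<^sub>0 - x)) \<longlonglongrightarrow> 0" by (rule tendsto_mult_left_zero)
      have "dist (X k $ i) (x $ i) \<le> dist (?q ^ k * norm1 (x\<^sub>0 - x)) 0" for k
      proof -
        have "\<bar>X k $ i - x $ i\<bar> \<le> ?q ^ k * norm1 (x\<^sub>0 - x)"
          using abs_index_le_norm1[of i "X k - x"] bound[of k] i
            stochastic_vec_carrier[OF sx] stochastic_vec_carrier[OF sX, of k] by simp
        also have "\<dots> \<le> \<bar>?q ^ k * norm1 (x\<^sub>0 - x)\<bar>" by (rule abs_ge_self)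
        finally show ?thesis unfolding dist_real_def diff_0_right .
      qed
      then show ?thesis by (intro metric_tendsto_imp_tendsto[OF null] always_eventually allI)
    qed
    ultimately show ?thesis using bound by blast
  qed
  ultimately show ?thesis by blast
qed

end
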